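(* Let $1<a\le 2$ and let $\varphi$ be the function on $[0,1]$ defined by $\varphi\left(\sum_{n=1}^{\infty}\frac{\alpha_n}{2^n}\right)=\sum_{n=1}^{\infty}\frac{\alpha_n}{a^n}$, $\alpha_n\in\{0,1\}$, where the classical binary representation of the argument is taken not to end with the infinite period $(1)$. Then the graph $\Gamma_\varphi$ of $\varphi$ is a self-affine subset of $\mathbb{R}^2$ whose self-affine dimension is $2\log_{2a}2$.
   Context: Numbers with two binary representations are represented by the one ending in zeros; the number $1$, whose only representation $\sum_{n\ge1}\alpha_n2^{-n}$ has all digits equal to $1$, is represented by it. The graph of $\varphi$ is $\Gamma_\varphi=\{(x,\varphi(x)):x\in[0,1]\}$. Terminology: a planar set is self-affine if it is a union of finitely many images of itself under contracting affine maps of the plane; its self-affine dimension is the number $s$ for which the sum, over these maps, of $|\det A|^{s/2}$ equals $1$, where $A$ denotes the linear part of the map.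
   Formalization: For 1<a<2 the full graph over [0,1] is not exactly self-affine; what is proved is self-affinity of the graph without its end point (1,φ(1)), and that the images of the full graph under the same maps give the graph plus the point (1/2,φ(1)/a), which lies in it for a=2. *)

theory Defs
  imports "HOL-Analysis.Analysis"
begin

(* The digit alpha_n, n \<ge> 1, is d (n - 1). Infinitely many zeros means that the
   expansion does not end with the period (1); the number 1 has only the
   expansion whose digits are all 1. *)
definition binary_expansion :: "(nat \<Rightarrow> nat) \<Rightarrow> real \<Rightarrow> bool" where
  "binary_expansion d x \<longleftrightarrow>
     (\<forall>n. d n \<in> {0, 1}) \<and>
     (\<lambda>n. real (d n) / 2 ^ Suc n) sums x \<and>
     (x \<noteq> 1 \<longrightarrow> infinite {n. d n = 0})"

definition binary_digits :: "real \<Rightarrow> nat \<Rightarrow> nat" where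
  "binary_digits x = (THE d. binary_expansion d x)"

definition phi :: "real \<Rightarrow> real \<Rightarrow> real" where
  "phi a x = (\<Sum>n. real (binary_digits x n) / a ^ Suc n)"

definition graph_on :: "real set \<Rightarrow> (real \<Rightarrow> real) \<Rightarrow> (real ^ 2) set" where
  "graph_on S f = (\<lambda>x. vector [x, f x]) ` S"

definition phi_graph :: "real \<Rightarrow> (real ^ 2) set" where
  "phi_graph a = graph_on {0..1} (phi a)"

definition linear_part :: "(real ^ 2 \<Rightarrow> real ^ 2) \<Rightarrow> real ^ 2 ^ 2" where
  "linear_part f = matrix (\<lambda>v. f v - f 0)"

definition contracting_affine :: "(real ^ 2 \<Rightarrow> real ^ 2) \<Rightarrow> bool" where
  "contracting_affine f \<longleftrightarrow>
     linear (\<lambda>v. f v - f 0) \<and> (\<exists>c<1. c-lipschitz_on UNIV f)"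

definition self_affine_by :: "(real ^ 2 \<Rightarrow> real ^ 2) set \<Rightarrow> (real ^ 2) set \<Rightarrow> bool" where
  "self_affine_by F E \<longleftrightarrow>
     finite F \<and> (\<forall>f\<in>F. contracting_affine f) \<and> E = (\<Union>f\<in>F. f ` E)"

(* The dimension depends on the family of maps and not only on the set. The equivalence
   says that s is the only solution of the equation. *)
definition self_affine_dimension :: "(real ^ 2 \<Rightarrow> real ^ 2) set \<Rightarrow> real \<Rightarrow> bool" where
  "self_affine_dimension F s \<longleftrightarrow>
     (\<forall>t. (\<Sum>f\<in>F. \<bar>det (linear_part f)\<bar> powr (t / 2)) = 1 \<longleftrightarrow> t = s)"

(* For 1 < a < 2 the full graph over {0..1} is not the union of finitely many images of
   itself under contracting affine maps: phi a is left-continuous at 1 but jumps at every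
   dyadic point of {0<..<1}, so no non-constant affine map carrying the graph into itself
   can send its end point (1, phi a 1) to a point with abscissa in {0<..<1}. The equation
   holds exactly once the end point is removed. With the end point, the images of the graph
   cover the graph and exceed it only by the image (1/2, phi a 1 / a) of the end point, which
   belongs to the graph for a = 2. *)
definition phi_graph_without_endpoint :: "real \<Rightarrow> (real ^ 2) set" where
  "phi_graph_without_endpoint a = phi_graph a - {vector [1, phi a 1]}"

end

theory Submission
  imports Defs
begin

text \<open>
  Prefixing a digit b to the expansion of x gives the expansion of (b + x) / 2, whence
  \<phi> ((b + x) / 2) = (b + \<phi> x) / a. So the graph over [0, 1) is the disjoint union of its images
  under (x, y) \<mapsto> ((b + x) / 2, (b + y) / a) for b = 0, 1. Both maps have determinant 1 / (2a), and
  the dimension equation 2 (2a) powr (-s/2) = 1 has the only solution s = 2 log (2a) 2.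
  The end point is fixed by the map with b = 1; the map with b = 0 moves it to the extra point.
\<close>

section \<open>Binary expansions\<close>

text \<open>Compared term by term with the series of all ones, whose sum is 1, the zero digit at
  \<open>k\<close> leaves a strict gap.\<close>

lemma binary_sum_less_1:
  assumes "\<And>n. d n \<in> {0, 1 :: nat}" and "(\<lambda>n. real (d n) / 2 ^ Suc n) sums x" and "d k = 0"
  shows "x < 1"
proof -
  have "(\<lambda>n. (1/2) ^ Suc n - real (d n) / 2 ^ Suc n) sums (1 - x)"
    by (intro sums_diff power_half_series assms(2))
  moreover have "0 < (\<Sum>n. (1/2) ^ Suc n - real (d n) / 2 ^ Suc n)"
  proof (rule suminf_pos2)
    show "summable (\<lambda>n. (1/2) ^ Suc n - real (d n) / 2 ^ Suc n)"
      using calculation by (rule sums_summable)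
    show "0 \<le> (1/2) ^ Suc n - real (d n) / 2 ^ Suc n" for n
      using assms(1)[of n] by (auto simp: power_one_over)
    show "0 < (1/2) ^ Suc k - real (d k) / 2 ^ Suc k"
      using assms(3) by simp
  qed
  ultimately show ?thesis
    by (simp add: sums_iff)
qed

lemma binary_expansion_nonneg: "binary_expansion d x \<Longrightarrow> 0 \<le> x"
  unfolding binary_expansion_def by (elim conjE, erule sums_le[OF _ sums_zero, rotated]) simp

text \<open>Doubling shifts the digits by one place. The strict bound \<open>x < 1\<close> supplies
  infinitely many zeros; a zero surviving in the tail keeps its value below 1 as well, so the lemma
  can be iterated.\<close>

lemma binary_expansion_tail:
  assumes "binary_expansion d x" and "x < 1"
  shows "binary_expansion (\<lambda>n. d (Suc n)) (2 * x - d 0)" and "2 * x - d 0 < 1"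
proof -
  have d: "d n \<in> {0, 1}" for n
    using assms(1) by (simp add: binary_expansion_def)
  have "(\<lambda>n. real (d (Suc n)) / 2 ^ Suc (Suc n)) sums (x - real (d 0) / 2)"
    using assms(1) sums_Suc_iff[of "\<lambda>n. real (d n) / 2 ^ Suc n" "x - real (d 0) / 2"]
    by (simp add: binary_expansion_def)
  from sums_mult[OF this, of 2]
  have s: "(\<lambda>n. real (d (Suc n)) / 2 ^ Suc n) sums (2 * x - d 0)"
    by (simp add: algebra_simps)
  \<comment> \<open>Dropping the first digit loses at most one zero.\<close>
  have "{n. d n = 0} \<subseteq> insert 0 (Suc ` {n. d (Suc n) = 0})"
  proof
    fix n
    assume "n \<in> {n. d n = 0}"
    then show "n \<in> insert 0 (Suc ` {n. d (Suc n) = 0})"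
      by (cases n) simp_all
  qed
  moreover have "infinite {n. d n = 0}"
    using assms by (simp add: binary_expansion_def)
  ultimately have inf: "infinite {n. d (Suc n) = 0}"
    by (meson finite_imageI finite_insert finite_subset)
  then obtain k where "d (Suc k) = 0"
    using not_finite_existsD by blast
  with s show "2 * x - d 0 < 1"
    by (intro binary_sum_less_1[of "\<lambda>n. d (Suc n)"]) (use d in auto)
  show "binary_expansion (\<lambda>n. d (Suc n)) (2 * x - d 0)"
    using s inf d by (simp add: binary_expansion_def)
qed

lemma binary_expansion_prefix:
  assumes "binary_expansion d x" and "x < 1" and "b \<in> {0, 1}"
  shows "binary_expansion (case_nat b d) ((b + x) / 2)"
proof -
  have "(\<lambda>n. real (d n) / 2 ^ Suc n / 2) sums (x / 2)"
    using assms(1) by (intro sums_divide) (simp add: binary_expansion_def)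
  then have "(\<lambda>n. real (case_nat b d n) / 2 ^ Suc n) sums (x / 2 + real (case_nat b d 0) / 2 ^ Suc 0)"
    by (intro sums_Suc) (simp add: field_simps)
  moreover have "Suc ` {n. d n = 0} \<subseteq> {n. case_nat b d n = 0}"
    by auto
  moreover have "infinite (Suc ` {n. d n = 0})"
    using assms(1,2) by (simp add: binary_expansion_def finite_image_iff)
  ultimately show ?thesis
    using assms(1,3)
    by (auto simp: binary_expansion_def add_divide_distrib add.commute dest: finite_subset
        split: nat.split)
qed

text \<open>The tail has the value \<open>2 * x - d 0\<close>, which lies in [0, 1).\<close>

lemma binary_expansion_first_digit:
  assumes "binary_expansion d x" and "x < 1"
  shows "int (d 0) = \<lfloor>2 * x\<rfloor>"
  using binary_expansion_tail[OF assms] binary_expansion_nonneg[OF binary_expansion_tail(1)[OF assms]]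
  by (intro floor_unique[symmetric]) auto

text \<open>The floor formula forces the first digit; both tails then expand the same number below
  1, and induction on the position applies.\<close>

lemma binary_expansion_unique_below_1:
  assumes "binary_expansion d x" and "binary_expansion e x" and "x < 1"
  shows "d n = e n"
  using assms
proof (induction n arbitrary: d e x)
  case (0 d e x)
  then show ?case
    by (metis binary_expansion_first_digit of_nat_eq_iff)
next
  case (Suc n d e x)
  then have "d 0 = e 0"
    by (metis binary_expansion_first_digit of_nat_eq_iff)
  with Suc.prems show ?case
    using Suc.IH[of "\<lambda>n. d (Suc n)" "2 * x - d 0" "\<lambda>n. e (Suc n)"]
      binary_expansion_tail[of d x] binary_expansion_tail(1)[of e x] by simp
qed

lemma binary_expansion_1_iff: "binary_expansion d 1 \<longleftrightarrow> d = (\<lambda>_. 1)"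
proof
  assume d: "binary_expansion d 1"
  then have "d n \<noteq> 0" for n
    using binary_sum_less_1[of d 1 n] by (auto simp: binary_expansion_def)
  with d show "d = (\<lambda>_. 1)"
    by (fastforce simp: binary_expansion_def)
next
  assume "d = (\<lambda>_. 1)"
  then show "binary_expansion d 1"
    using power_half_series by (simp add: binary_expansion_def power_one_over)
qed

text \<open>The digits are read off from the dyadic floors \<open>q n\<close>. The partial sums
  telescope to \<open>q n / 2 ^ n\<close>, which tends to \<open>x\<close>, and taking floors from
  below excludes an infinite period (1).\<close>

lemma binary_expansion_exists_below_1:
  assumes "0 \<le> x" and "x < 1"
  shows "\<exists>d. binary_expansion d x"
proof -
  define q where "q n = \<lfloor>2 ^ n * x\<rfloor>" for n :: nat
  define d where "d n = nat (q (Suc n) - 2 * q n)" for n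
  have q: "q (Suc n) - 2 * q n \<in> {0, 1}" for n
    unfolding q_def power_Suc mult.assoc by (simp; linarith)
  have int_d: "int (d n) = q (Suc n) - 2 * q n" for n
    using q[of n] by (auto simp: d_def)
  have "q 0 = 0"
    using assms by (simp add: q_def floor_eq_iff)
  have real_d: "real (d n) = q (Suc n) - 2 * q n" for n
    by (metis int_d of_int_of_nat_eq)
  have "(\<lambda>n. real_of_int (q n) / 2 ^ n) \<longlonglongrightarrow> x"
  proof (rule tendsto_sandwich)
    have le: "real_of_int (q n) \<le> 2 ^ n * x" and ge: "2 ^ n * x - 1 \<le> real_of_int (q n)" for n
      unfolding q_def by linarith+
    show "\<forall>\<^sub>F n in sequentially. real_of_int (q n) / 2 ^ n \<le> x"
      using le by (simp add: pos_divide_le_eq mult.commute)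
    have "x - (1/2) ^ n \<le> real_of_int (q n) / 2 ^ n" for n
      using divide_right_mono[OF ge[of n], of "2 ^ n"] by (simp add: diff_divide_distrib power_one_over)
    then show "\<forall>\<^sub>F n in sequentially. x - (1/2) ^ n \<le> real_of_int (q n) / 2 ^ n"
      by simp
    show "(\<lambda>n. x - (1/2) ^ n) \<longlonglongrightarrow> x"
      by (rule tendsto_eq_intros LIMSEQ_power_zero | simp)+
  qed simp
  \<comment> \<open>Each difference equals the digit term \<open>d n / 2 ^ Suc n\<close>.\<close>
  then have "(\<lambda>n. real_of_int (q (Suc n)) / 2 ^ Suc n - real_of_int (q n) / 2 ^ n) sums (x - 0)"
    using telescope_sums[of "\<lambda>n. real_of_int (q n) / 2 ^ n" x] \<open>q 0 = 0\<close> by simp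
  then have sums: "(\<lambda>n. real (d n) / 2 ^ Suc n) sums x"
    by (simp add: real_d field_simps)
  have "infinite {n. d n = 0}"
  proof
    assume "finite {n. d n = 0}"
    then obtain N where "\<forall>n\<in>{n. d n = 0}. n < N"
      using finite_nat_set_iff_bounded by blast
    then have N: "d n \<noteq> 0" if "n \<ge> N" for n
      using that by (meson leD mem_Collect_eq)
    have step: "q (Suc n) = 2 * q n + 1" if "n \<ge> N" for n
      using N[OF that] int_d[of n] q[of n] by auto
    \<comment> \<open>With all digits from \<open>N\<close> on equal to 1, the upper end
      \<open>q n + 1\<close> doubles at each step.\<close>
    have qN: "q (N + k) + 1 = 2 ^ k * (q N + 1)" for k
      by (induction k) (auto simp: step algebra_simps)
    \<comment> \<open>The gap from \<open>2 ^ N * x\<close> up to the next integer. It doubles along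
      with the upper end, yet no gap of this kind exceeds 1, which is impossible for large
      \<open>k\<close>.\<close>
    define r where "r = real_of_int (q N) + 1 - 2 ^ N * x"
    have "r > 0"
      unfolding r_def q_def by linarith
    have bound: "2 ^ k * r \<le> 1" for k
    proof -
      have "real_of_int (q (N + k)) + 1 = 2 ^ k * (real_of_int (q N) + 1)"
        using arg_cong[OF qN[of k], of real_of_int] by simp
      moreover have "real_of_int (q (N + k)) \<le> 2 ^ (N + k) * x"
        unfolding q_def by linarith
      ultimately show ?thesis
        by (simp add: r_def algebra_simps power_add)
    qed
    obtain k where "1 / r < 2 ^ k"
      using real_arch_pow[of 2 "1 / r"] by auto
    with bound[of k] \<open>r > 0\<close> show False
      by (simp add: field_simps)
  qed
  moreover have "d n \<in> {0, 1}" for n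
    using q[of n] by (auto simp: d_def)
  ultimately show ?thesis
    using sums unfolding binary_expansion_def by blast
qed

text \<open>Justifies the definite description in \<open>binary_digits\<close>: at 1 only the
  constant 1 qualifies, and below 1 the digits are forced one by one.\<close>

lemma binary_digits_eqI:
  assumes "binary_expansion d x" and "x \<le> 1"
  shows "binary_digits x = d"
  unfolding binary_digits_def
proof (rule the_equality)
  show "e = d" if "binary_expansion e x" for e
  proof (cases "x = 1")
    case True
    with assms that show ?thesis by (simp add: binary_expansion_1_iff)
  next
    case False
    with assms that show ?thesis
      by (intro ext binary_expansion_unique_below_1[of _ x]) auto
  qed
qed (fact assms(1))

section \<open>Self-affinity of the graph\<close>

text \<open>A geometric series of ratio \<open>1 / a\<close>. Its value is the fixed point of y = (1
  + y) / a.\<close>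

lemma phi_1:
  assumes "1 < a"
  shows "phi a 1 = 1 / (a - 1)"
proof -
  have "binary_digits 1 = (\<lambda>_. 1)"
    by (intro binary_digits_eqI) (simp_all add: binary_expansion_1_iff)
  moreover have "(\<lambda>n. (1 / a) * (1 / a) ^ n) sums ((1 / a) * (1 / (1 - 1 / a)))"
    using assms by (intro sums_mult geometric_sums) simp
  moreover have "(1 / a) * (1 / (1 - 1 / a)) = 1 / (a - 1)"
    using assms by (simp add: field_simps)
  ultimately show ?thesis
    by (simp add: phi_def sums_iff power_one_over)
qed

text \<open>Shifting the digits divides the series by \<open>a\<close>, and the new digit adds
  \<open>b / a\<close>. For \<open>a < 2\<close> the identity breaks down at \<open>x = 1\<close>,
  \<open>b = 0\<close>.\<close>

lemma phi_prefix:
  assumes "1 < a" and "x \<in> {0..<1}" and "b \<in> {0, 1 :: nat}"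
  shows "phi a ((b + x) / 2) = (b + phi a x) / a"
proof -
  obtain d where d: "binary_expansion d x"
    using binary_expansion_exists_below_1 assms(2) by auto
  have "binary_digits ((b + x) / 2) = case_nat b d"
    using binary_expansion_prefix[OF d, of b] assms(2,3)
    by (intro binary_digits_eqI) auto
  moreover have "binary_digits x = d"
    using d assms(2) by (intro binary_digits_eqI) auto
  \<comment> \<open>Convergence by comparison with a geometric series of ratio \<open>1 / a\<close>,
    which is below 1.\<close>
  moreover have "summable (\<lambda>n. real (d n) / a ^ Suc n)"
  proof (rule summable_comparison_test')
    show "summable (\<lambda>n. (1 / a) ^ Suc n)"
      using assms(1) by (simp only: summable_Suc_iff) (simp add: summable_geometric)
    show "norm (real (d n) / a ^ Suc n) \<le> (1 / a) ^ Suc n" if "n \<ge> 0" for n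
    proof -
      have "d n \<le> 1"
        using d unfolding binary_expansion_def
        by (metis insertE le_numeral_extra(3,4) singletonD zero_le_one)
      then show ?thesis
        using assms(1) by (simp add: power_one_over divide_right_mono)
    qed
  qed
  then have "(\<lambda>n. real (d n) / a ^ Suc n / a) sums ((\<Sum>n. real (d n) / a ^ Suc n) / a)"
    by (intro sums_divide summable_sums)
  then have "(\<lambda>n. real (case_nat b d n) / a ^ Suc n) sums
      ((\<Sum>n. real (d n) / a ^ Suc n) / a + real (case_nat b d 0) / a ^ Suc 0)"
    by (intro sums_Suc) (simp add: field_simps)
  ultimately show ?thesis
    by (simp add: phi_def sums_iff add_divide_distrib)
qed

section \<open>The two affine maps: contraction and dimension\<close>

definition prefix_map :: "real \<Rightarrow> real \<Rightarrow> real ^ 2 \<Rightarrow> real ^ 2" where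
  "prefix_map a b v = vector [(b + v $ 1) / 2, (b + v $ 2) / a]"

lemma prefix_map_vector [simp]:
  "prefix_map a b (vector [x, y]) = vector [(b + x) / 2, (b + y) / a]"
  by (simp add: prefix_map_def)

text \<open>Ensures that a sum over the set of the two maps has two terms.\<close>

lemma prefix_map_0_neq_1: "prefix_map a 0 \<noteq> prefix_map a 1"
proof
  assume "prefix_map a 0 = prefix_map a 1"
  then have "prefix_map a 0 0 $ 1 = prefix_map a 1 0 $ 1"
    by simp
  then show False
    by (simp add: prefix_map_def)
qed

text \<open>The linear part is diagonal with entries 1/2 and \<open>1 / a\<close>, the same for both
  digits.\<close>

lemma prefix_map_minus_0:
  "prefix_map a b v - prefix_map a b 0 = vector [v $ 1 / 2, v $ 2 / a]"
  by (simp add: prefix_map_def vec_eq_iff forall_2 add_divide_distrib)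

text \<open>Since \<open>a \<le> 2\<close>, the horizontal factor 1/2 is at most the vertical factor
  \<open>1 / a\<close>, which thus serves as the Lipschitz constant and is below 1.\<close>

lemma contracting_affine_prefix_map:
  assumes "1 < a" and "a \<le> 2"
  shows "contracting_affine (prefix_map a b)"
  unfolding contracting_affine_def prefix_map_minus_0
proof
  show "linear (\<lambda>v :: real ^ 2. vector [v $ 1 / 2, v $ 2 / a] :: real ^ 2)"
    by (intro linearI) (simp_all add: vec_eq_iff forall_2 add_divide_distrib)
  have "(1 / a)-lipschitz_on UNIV (prefix_map a b)"
  proof (rule lipschitz_onI)
    fix v w :: "real ^ 2"
    have "norm (prefix_map a b v - prefix_map a b w) \<le> norm ((1 / a) *\<^sub>R (v - w))"
    proof (rule norm_le_componentwise_cart)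
      have "\<bar>v $ 1 - w $ 1\<bar> * (1 / 2) \<le> \<bar>v $ 1 - w $ 1\<bar> * (1 / a)"
        using assms by (intro mult_left_mono) (auto simp: field_simps)
      then have "\<forall>i. norm ((prefix_map a b v - prefix_map a b w) $ i) \<le> norm (((1 / a) *\<^sub>R (v - w)) $ i)"
        using assms
        by (simp add: forall_2 prefix_map_def abs_mult abs_divide flip: diff_divide_distrib)
      then show "norm ((prefix_map a b v - prefix_map a b w) $ i) \<le> norm (((1 / a) *\<^sub>R (v - w)) $ i)" for i
        by blast
    qed
    then show "dist (prefix_map a b v) (prefix_map a b w) \<le> 1 / a * dist v w"
      using assms by (simp add: dist_norm)
  qed (use assms in simp)
  then show "\<exists>c<1. c-lipschitz_on UNIV (prefix_map a b)"
    using assms by (intro exI[of _ "1 / a"]) simp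
qed

lemma det_linear_part_prefix_map: "det (linear_part (prefix_map a b)) = 1 / (2 * a)"
  by (simp add: det_2 linear_part_def matrix_def prefix_map_minus_0 axis_def)

lemma self_affine_dimension_prefix_maps:
  assumes "1 < a"
  shows "self_affine_dimension {prefix_map a 0, prefix_map a 1} (2 * log (2 * a) 2)"
  unfolding self_affine_dimension_def
proof
  fix t
  have "(\<Sum>f\<in>{prefix_map a 0, prefix_map a 1}. \<bar>det (linear_part f)\<bar> powr (t / 2)) =
      2 / (2 * a) powr (t / 2)"
    using assms
    by (simp add: prefix_map_0_neq_1 det_linear_part_prefix_map powr_divide)
  also have "\<dots> = 1 \<longleftrightarrow> (2 * a) powr (t / 2) = 2"
    using assms by (auto simp: field_simps)
  \<comment> \<open>Writing 2 as a power of \<open>2 * a\<close> makes injectivity of the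
    exponential with base \<open>2 * a > 1\<close> applicable.\<close>
  also have "\<dots> \<longleftrightarrow> (2 * a) powr (t / 2) = (2 * a) powr log (2 * a) 2"
    using assms by simp
  also have "\<dots> \<longleftrightarrow> t = 2 * log (2 * a) 2"
    using assms by (subst powr_inj) auto
  finally show "(\<Sum>f\<in>{prefix_map a 0, prefix_map a 1}. \<bar>det (linear_part f)\<bar> powr (t / 2)) = 1 \<longleftrightarrow>
      t = 2 * log (2 * a) 2" .
qed

section \<open>Decomposition of the graph\<close>

lemma vector_2_eq_iff: "(vector [x, y] :: 'a :: zero ^ 2) = vector [x', y'] \<longleftrightarrow> x = x' \<and> y = y'"
  by (simp add: vec_eq_iff forall_2)

text \<open>A point of the graph is determined by its abscissa, so deleting the end point deletes
  just 1 from the domain.\<close>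

lemma phi_graph_without_endpoint_eq: "phi_graph_without_endpoint a = graph_on {0..<1} (phi a)"
  by (force simp: phi_graph_without_endpoint_def phi_graph_def graph_on_def vector_2_eq_iff)

lemma phi_graph_eq_insert:
  "phi_graph a = insert (vector [1, phi a 1]) (phi_graph_without_endpoint a)"
  by (auto simp: phi_graph_without_endpoint_def phi_graph_def graph_on_def)

lemma phi_graph_without_endpoint_self_similar:
  assumes "1 < a"
  shows "phi_graph_without_endpoint a =
    prefix_map a 0 ` phi_graph_without_endpoint a \<union> prefix_map a 1 ` phi_graph_without_endpoint a"
proof -
  \<comment> \<open>By \<open>phi_prefix\<close>, each map carries the graph over [0, 1) onto the
    graph over a half of that interval.\<close>
  have img: "prefix_map a (real b) ` graph_on {0..<1} (phi a) =
      graph_on ((\<lambda>x. (real b + x) / 2) ` {0..<1}) (phi a)" if "b \<in> {0, 1}" for b :: nat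
    unfolding graph_on_def image_image
    by (intro image_cong) (simp_all add: phi_prefix[OF assms _ that])
  have "{0..<1} = (\<lambda>x. (0 + x) / 2) ` {0..<1} \<union> (\<lambda>x. (1 + x) / 2) ` {0..<1 :: real}"
  proof (intro equalityI subsetI)
    fix x :: real
    assume "x \<in> {0..<1}"
    then show "x \<in> (\<lambda>x. (0 + x) / 2) ` {0..<1} \<union> (\<lambda>x. (1 + x) / 2) ` {0..<1}"
      by (cases "x < 1 / 2")
        (auto intro: image_eqI[where x = "2 * x"] image_eqI[where x = "2 * x - 1"])
  qed auto
  then have "graph_on {0..<1} (phi a) = graph_on ((\<lambda>x. (0 + x) / 2) ` {0..<1}) (phi a) \<union>
      graph_on ((\<lambda>x. (1 + x) / 2) ` {0..<1}) (phi a)"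
    unfolding graph_on_def by (metis image_Un)
  then show ?thesis
    using img[of 0] img[of 1] by (simp add: phi_graph_without_endpoint_eq)
qed

theorem lemma4:
  fixes a :: real
  assumes "1 < a" and "a \<le> 2"
  shows "\<exists>F. self_affine_by F (phi_graph_without_endpoint a) \<and>
             (\<Union>f\<in>F. f ` phi_graph a) = phi_graph a \<union> {vector [1 / 2, phi a 1 / a]} \<and>
             self_affine_dimension F (2 * log (2 * a) 2)"
proof (intro exI conjI)
  let ?F = "{prefix_map a 0, prefix_map a 1}" and ?G = "phi_graph_without_endpoint a"
  have G: "?G = prefix_map a 0 ` ?G \<union> prefix_map a 1 ` ?G"
    using assms(1) by (rule phi_graph_without_endpoint_self_similar)
  show "self_affine_by ?F ?G"
    unfolding self_affine_by_def
  proof (intro conjI)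
    show "?G = (\<Union>f\<in>?F. f ` ?G)"
      using G by (simp only: UN_insert UN_empty Un_empty_right)
  qed (use assms contracting_affine_prefix_map in auto)
  \<comment> \<open>So the map with digit 1 fixes the end point, and only the map with digit 0 can
    produce a new point from it.\<close>
  have "(1 + phi a 1) / a = phi a 1"
    using assms(1) by (simp add: phi_1 field_simps)
  then have "(\<Union>f\<in>?F. f ` phi_graph a) = (prefix_map a 0 ` ?G \<union> prefix_map a 1 ` ?G) \<union>
      {vector [1, phi a 1], vector [1 / 2, phi a 1 / a]}"
    by (auto simp: phi_graph_eq_insert)
  also have "\<dots> = phi_graph a \<union> {vector [1 / 2, phi a 1 / a]}"
    unfolding G[symmetric] by (auto simp: phi_graph_eq_insert)
  finally show "(\<Union>f\<in>?F. f ` phi_graph a) = phi_graph a \<union> {vector [1 / 2, phi a 1 / a]}" .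
  show "self_affine_dimension ?F (2 * log (2 * a) 2)"
    using assms(1) by (rule self_affine_dimension_prefix_maps)
qed

end
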